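(* Suppose $Z\subset\mathbf{R}^3$ is a nonempty $(2,0)$ set that lies in a halfspace of $\mathbf{R}^3$. Then $Z$ contains a plane. Indeed, if $L:\mathbf{R}^3\to\mathbf{R}$ is a nonconstant linear function and if $$s:=\sup_Z L<\infty,$$ then $Z$ contains the plane $\{L=s\}$.
   Context: A closed subset $Z\subset\mathbf{R}^3$ (with the Euclidean metric) is a $(2,0)$ set if, whenever $f:\mathbf{R}^3\to\mathbf{R}$ is a $C^2$ function such that $f|Z$ has a local maximum at $p\in Z$, the sum of the two lowest eigenvalues (counted with multiplicity) of the Hessian of $f$ at $p$ is $\le0$. *)

theory Defs
  imports "HOL-Analysis.Analysis" "HOL-Library.Multiset"
begin

definition gradient :: "(real ^ 'n \<Rightarrow> real) \<Rightarrow> real ^ 'n \<Rightarrow> real ^ 'n" where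
  "gradient f x = (\<chi> i. frechet_derivative f (at x) (axis i 1))"

definition hessian :: "(real ^ 'n \<Rightarrow> real) \<Rightarrow> real ^ 'n \<Rightarrow> real ^ 'n ^ 'n" where
  "hessian f x = jacobian (gradient f) (at x)"

definition C2 :: "(real ^ 'n \<Rightarrow> real) \<Rightarrow> bool" where
  "C2 f \<longleftrightarrow> f differentiable_on UNIV \<and> gradient f differentiable_on UNIV
     \<and> continuous_on UNIV (hessian f)"

definition eigenspace :: "real ^ 'n ^ 'n \<Rightarrow> real \<Rightarrow> (real ^ 'n) set" where
  "eigenspace A l = {v. A *v v = l *\<^sub>R v}"

definition eigenvalues :: "real ^ 'n ^ 'n \<Rightarrow> real set" where
  "eigenvalues A = {l. \<exists>v. v \<noteq> 0 \<and> A *v v = l *\<^sub>R v}"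

text \<open>Each eigenvalue is repeated according to the dimension of its eigenspace. For symmetric
  matrices, such as Hessians of \<open>C2\<close> functions, this is also the algebraic multiplicity,
  so the multiset has as many elements as the matrix has rows.\<close>

definition eigenvalue_mset :: "real ^ 'n ^ 'n \<Rightarrow> real multiset" where
  "eigenvalue_mset A = (\<Sum>l\<in>eigenvalues A. replicate_mset (dim (eigenspace A l)) l)"

definition sum_two_lowest_eigenvalues :: "real ^ 'n ^ 'n \<Rightarrow> real" where
  "sum_two_lowest_eigenvalues A =
     sum_list (take 2 (sorted_list_of_multiset (eigenvalue_mset A)))"

definition local_max_on :: "('a::topological_space \<Rightarrow> real) \<Rightarrow> 'a set \<Rightarrow> 'a \<Rightarrow> bool" where
  "local_max_on f Z p \<longleftrightarrow> p \<in> Z \<and> (\<forall>\<^sub>F x in at p within Z. f x \<le> f p)"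

definition two_zero_set :: "(real ^ 3) set \<Rightarrow> bool" where
  "two_zero_set Z \<longleftrightarrow> closed Z \<and>
     (\<forall>f p. C2 f \<and> local_max_on f Z p \<longrightarrow> sum_two_lowest_eigenvalues (hessian f p) \<le> 0)"

definition halfspace :: "(real ^ 'n) set \<Rightarrow> bool" where
  "halfspace H \<longleftrightarrow> (\<exists>a b. a \<noteq> 0 \<and> H = {x. a \<bullet> x \<le> b})"

definition plane :: "(real ^ 3) set \<Rightarrow> bool" where
  "plane P \<longleftrightarrow> (\<exists>a b. a \<noteq> 0 \<and> P = {x. a \<bullet> x = b})"

end

theory Submission
  imports Defs
begin

text \<open>A function whose level set through \<open>p\<close> is strictly mean-convex cannot attain a local maximum
  at \<open>p\<close> on a (2,0) set: after composition with a sufficiently convex exponential its Hessian has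
  positive trace on every 2-plane. Suppose that a point \<open>q\<close> of the plane \<open>z = 0\<close>, where \<open>z\<close> is the
  signed height with supremum 0 on \<open>Z\<close>, is missing from \<open>Z\<close>. Then a ball around \<open>q\<close> is missing too,
  so \<open>z\<close> is bounded away from 0 on the part of \<open>Z\<close> in a thin cylinder about the normal line at \<open>q\<close>.
  As in the Hoffman--Meeks halfspace theorem, one compares with surfaces that grow logarithmically
  in the distance \<open>r\<close> to that line: for small \<open>e\<close> the function
  \<open>z - e H(k r\<^sup>2)\<close> attains its maximum over \<open>Z\<close>, and does so outside the cylinder,
  where its level sets, slightly bent catenoid ends, are strictly mean-convex.\<close>

section \<open>Derivatives\<close>

lemma gradient_eqI:
  fixes f :: "real ^ 'n \<Rightarrow> real"
  assumes "(f has_derivative (\<lambda>h. g \<bullet> h)) (at x)"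
  shows "gradient f x = g"
proof -
  have "frechet_derivative f (at x) = (\<lambda>h. g \<bullet> h)"
    using frechet_derivative_at[OF assms] by simp
  then show ?thesis
    by (simp add: gradient_def vec_eq_iff inner_axis)
qed

text \<open>With explicit \<open>g\<close> and \<open>B\<close>, the Hessian is never unfolded
  again: its columns are the values of \<open>B x\<close> on the basis vectors, so continuity is
  checked for one fixed direction \<open>h\<close> at a time.\<close>

lemma C2_and_hessian:
  fixes f :: "real ^ 'n \<Rightarrow> real" and B :: "real ^ 'n \<Rightarrow> real ^ 'n \<Rightarrow> real ^ 'n"
  assumes f: "\<And>x. (f has_derivative (\<lambda>h. g x \<bullet> h)) (at x)"
    and g: "\<And>x. (g has_derivative B x) (at x)"
    and B: "\<And>h. continuous_on UNIV (\<lambda>x. B x h)"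
  shows "C2 f" "hessian f x *v h = B x h"
proof -
  have grad: "gradient f = g"
    using gradient_eqI[OF f] by blast
  have hess: "hessian f = (\<lambda>x. matrix (B x))"
    unfolding hessian_def grad jacobian_def frechet_derivative_at[OF g, symmetric] ..
  have "continuous_on UNIV (\<lambda>x. matrix (B x))"
    unfolding matrix_def by (intro continuous_on_vec_lambda continuous_on_component B)
  with f g show "C2 f"
    unfolding C2_def grad hess
    by (auto simp: differentiable_on_def differentiable_def intro: has_derivative_at_withinI)
  have "linear (B x)"
    using g has_derivative_linear by blast
  then show "hessian f x *v h = B x h"
    by (simp add: hess matrix_works)
qed

section \<open>Symmetric matrices\<close>

text \<open>The quadratic form attains its maximum \<open>l\<close> on the compact unit sphere of
  \<open>S\<close>, and a maximiser is an eigenvector.\<close>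

lemma symmetric_eigenvector_in_invariant_subspace:
  fixes A :: "real ^ 'n ^ 'n"
  assumes sym: "\<And>x y. x \<bullet> (A *v y) = (A *v x) \<bullet> y"
    and S: "subspace S" "\<And>x. x \<in> S \<Longrightarrow> A *v x \<in> S" and "S \<noteq> {0}"
  obtains u l where "u \<in> S" "u \<noteq> 0" "A *v u = l *\<^sub>R u"
proof -
  obtain s where s: "s \<in> S" "s \<noteq> 0"
    using S(1) \<open>S \<noteq> {0}\<close> subspace_0 by blast
  have "compact (sphere 0 1 \<inter> S)"
    by (intro compact_Int_closed compact_sphere closed_subspace S(1))
  moreover have "(1 / norm s) *\<^sub>R s \<in> sphere 0 1 \<inter> S"
    using s S(1) by (simp add: subspace_mul)
  then have "sphere 0 1 \<inter> S \<noteq> {}" by blast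
  moreover have "continuous_on (sphere 0 1 \<inter> S) (\<lambda>x. x \<bullet> (A *v x))"
    by (intro continuous_intros matrix_vector_mult_linear_continuous_on)
  ultimately obtain u where u: "u \<in> sphere 0 1 \<inter> S"
    and max: "\<And>x. x \<in> sphere 0 1 \<inter> S \<Longrightarrow> x \<bullet> (A *v x) \<le> u \<bullet> (A *v u)"
    using continuous_attains_sup[of "sphere 0 1 \<inter> S" "\<lambda>x. x \<bullet> (A *v x)"] by blast
  define l where "l = u \<bullet> (A *v u)"
  have uS: "u \<in> S" and "norm u = 1"
    using u by simp_all
  then have u1: "u \<bullet> u = 1"
    by (simp only: dot_square_norm power_one)
  have q: "x \<bullet> (A *v x) \<le> l * (x \<bullet> x)" if "x \<in> S" for x
  proof (cases "x = 0")
    case False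
    then have "(1 / norm x) *\<^sub>R x \<in> sphere 0 1 \<inter> S"
      using that S(1) by (simp add: subspace_mul)
    from max[OF this] show ?thesis
      using False
      by (simp add: l_def scaleR_matrix_vector_assoc[symmetric] matrix_vector_mult_scaleR field_simps
          dot_square_norm power2_eq_square)
  qed simp
  \<comment> \<open>The form \<open>l * (x \<bullet> x) - x \<bullet> (A *v x)\<close> is
    nonnegative on \<open>S\<close> and zero at \<open>u\<close>, so its first variation at
    \<open>u\<close> vanishes.\<close>
  have "u \<bullet> (l *\<^sub>R w - A *v w) = 0" if w: "w \<in> S" for w
  proof -
    define c where "c = u \<bullet> (l *\<^sub>R w - A *v w)"
    define d where "d = l * (w \<bullet> w) - w \<bullet> (A *v w)"
    have "0 \<le> 2 * t * c + t\<^sup>2 * d" for t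
    proof -
      have "u + t *\<^sub>R w \<in> S" using uS w S(1) by (simp add: subspace_add subspace_mul)
      from q[OF this] show ?thesis
        using sym[of w u]
        by (simp add: c_def d_def u1 l_def inner_simps matrix_vector_right_distrib
            matrix_vector_mult_scaleR power2_eq_square algebra_simps inner_commute)
    qed
    note quad = this
    have "0 \<le> d" using q[OF w] by (simp add: d_def)
    \<comment> \<open>The minimiser would be \<open>- c / d\<close>; the denominator
      \<open>d + 1\<close> also covers \<open>d = 0\<close> and still gives a negative value unless
      \<open>c = 0\<close>.\<close>
    have "0 \<le> 2 * (- c / (d + 1)) * c + (- c / (d + 1))\<^sup>2 * d" by (rule quad)
    also have "\<dots> = - (c\<^sup>2 * (d + 2) / (d + 1)\<^sup>2)"
      using \<open>0 \<le> d\<close> by (simp add: divide_simps) (simp add: algebra_simps power2_eq_square)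
    finally have "c\<^sup>2 * (d + 2) / (d + 1)\<^sup>2 \<le> 0" by simp
    then have "c = 0"
      using \<open>0 \<le> d\<close> by (simp add: divide_le_0_iff mult_le_0_iff)
    then show ?thesis by (simp add: c_def)
  qed
  then have "(l *\<^sub>R u - A *v u) \<bullet> w = 0" if "w \<in> S" for w
    using that sym[of u w] by (simp add: inner_diff_left inner_diff_right)
  \<comment> \<open>Invariance puts the residual itself into \<open>S\<close>, so it can be tested
    against itself.\<close>
  from this[of "l *\<^sub>R u - A *v u"] have "(l *\<^sub>R u - A *v u) \<bullet> (l *\<^sub>R u - A *v u) = 0"
    using S uS by (simp add: subspace_diff subspace_mul)
  then have "A *v u = l *\<^sub>R u" by simp
  with uS u1 that show ?thesis by force
qed

lemma symmetric_eigenvectors_orthogonal: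
  fixes A :: "real ^ 'n ^ 'n"
  assumes sym: "\<And>x y. x \<bullet> (A *v y) = (A *v x) \<bullet> y"
    and "A *v u = a *\<^sub>R u" "A *v w = b *\<^sub>R w" "a \<noteq> b"
  shows "u \<bullet> w = 0"
  using sym[of u w] assms(2-) by simp

text \<open>Eigenvectors of distinct eigenvalues are orthogonal, hence independent. Finiteness
  matters because the sum defining \<open>eigenvalue_mset\<close> defaults to the empty multiset
  over an infinite index set.\<close>

lemma finite_eigenvalues_symmetric:
  fixes A :: "real ^ 'n ^ 'n"
  assumes sym: "\<And>x y. x \<bullet> (A *v y) = (A *v x) \<bullet> y"
  shows "finite (eigenvalues A)"
proof -
  obtain e where e: "\<And>l. l \<in> eigenvalues A \<Longrightarrow> e l \<noteq> 0 \<and> A *v e l = l *\<^sub>R e l"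
  proof -
    have "\<forall>l \<in> eigenvalues A. \<exists>v. v \<noteq> 0 \<and> A *v v = l *\<^sub>R v"
      by (simp add: eigenvalues_def)
    then show thesis using that by (auto dest!: bchoice)
  qed
  have "inj_on e (eigenvalues A)"
    by (rule inj_onI) (metis e scaleR_right_imp_eq)
  moreover have "independent (e ` eigenvalues A)"
  proof (rule pairwise_orthogonal_independent)
    show "pairwise orthogonal (e ` eigenvalues A)"
      using e symmetric_eigenvectors_orthogonal[OF sym]
      by (auto simp: pairwise_def orthogonal_def) metis
    show "0 \<notin> e ` eigenvalues A" using e by force
  qed
  then have "finite (e ` eigenvalues A)" using independent_imp_finite by blast
  ultimately show ?thesis using finite_imageD by blast
qed

lemma subspace_eigenspace: "subspace (eigenspace A l)"
  by (auto simp: subspace_def eigenspace_def matrix_vector_right_distrib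
      matrix_vector_mult_scaleR scaleR_add_right)

lemma count_eigenvalue_mset:
  assumes "finite (eigenvalues A)"
  shows "count (eigenvalue_mset A) l = dim (eigenspace A l)"
proof -
  have "count (eigenvalue_mset A) l = (if l \<in> eigenvalues A then dim (eigenspace A l) else 0)"
    using assms by (simp add: eigenvalue_mset_def count_sum if_distrib cong: if_cong)
  moreover have "eigenspace A l = {0}" if "l \<notin> eigenvalues A"
    using that by (auto simp: eigenspace_def eigenvalues_def)
  ultimately show ?thesis by auto
qed

lemma orthogonal_pair_if_dim_ge_2:
  fixes S :: "'a::euclidean_space set"
  assumes "subspace S" "2 \<le> dim S"
  obtains u w where "u \<in> S" "w \<in> S" "u \<noteq> 0" "w \<noteq> 0" "u \<bullet> w = 0"
proof -
  obtain B where B: "B \<subseteq> S" "pairwise orthogonal B" "0 \<notin> B" "card B = dim S"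
  proof -
    obtain B where "B \<subseteq> S" "pairwise orthogonal B" "independent B" "card B = dim S"
      using orthonormal_basis_subspace[OF \<open>subspace S\<close>] by metis
    then show thesis using that dependent_zero by blast
  qed
  then obtain u w where "u \<in> B" "w \<in> B" "u \<noteq> w"
    using assms(2) by (metis card_le_Suc0_iff_eq card.infinite not_less_eq_eq numeral_2_eq_2 not_numeral_le_zero)
  with B have "u \<in> S" "w \<in> S" "u \<noteq> 0" "w \<noteq> 0" "u \<bullet> w = 0"
    by (auto simp: pairwise_def orthogonal_def)
  then show ?thesis by (rule that)
qed

text \<open>The two lowest entries have orthogonal eigenvectors: by symmetry if the values differ,
  inside one eigenspace of dimension at least 2 if they agree. Their sum is thus a trace over a
  2-plane.\<close>

lemma sum_two_lowest_eigenvalues_pos: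
  fixes A :: "real ^ 'n ^ 'n"
  assumes sym: "\<And>x y. x \<bullet> (A *v y) = (A *v x) \<bullet> y"
    and card: "2 \<le> CARD('n)"
    and pos: "\<And>u w. norm u = 1 \<Longrightarrow> norm w = 1 \<Longrightarrow> u \<bullet> w = 0
                 \<Longrightarrow> 0 < u \<bullet> (A *v u) + w \<bullet> (A *v w)"
  shows "0 < sum_two_lowest_eigenvalues A"
proof -
  let ?M = "eigenvalue_mset A"
  note count = count_eigenvalue_mset[OF finite_eigenvalues_symmetric[OF sym]]
  have pos': "0 < a + b"
    if "u \<noteq> 0" "w \<noteq> 0" "u \<bullet> w = 0" "A *v u = a *\<^sub>R u" "A *v w = b *\<^sub>R w" for u w a b
    using pos[of "sgn u" "sgn w"] that
    by (simp add: sgn_div_norm matrix_vector_mult_scaleR dot_square_norm power2_eq_square field_simps)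
  have dim1: "0 < dim (eigenspace A l)" if "u \<noteq> 0" "A *v u = l *\<^sub>R u" for u l
    using that by (auto simp: eigenspace_def intro!: Nat.gr0I)
  have "UNIV \<noteq> {0::real^'n}"
    by (metis UNIV_I axis_eq_0_iff singletonD zero_neq_one)
  then obtain u a where u: "u \<noteq> 0" "A *v u = a *\<^sub>R u"
    using symmetric_eigenvector_in_invariant_subspace[OF sym subspace_UNIV] by blast
  \<comment> \<open>Symmetry makes this hyperplane invariant, which supplies a second eigenvector.
    Two entries must be exhibited, since \<open>take 2\<close> would silently return a shorter
    list.\<close>
  let ?S = "{x. u \<bullet> x = 0}"
  have "dim ?S \<noteq> 0"
    using u(1) card by (simp add: dim_hyperplane)
  then have "?S \<noteq> {0}" by auto
  moreover have "A *v x \<in> ?S" if "x \<in> ?S" for x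
    using that sym[of u x] u(2) by simp
  ultimately obtain w b where w: "u \<bullet> w = 0" "w \<noteq> 0" "A *v w = b *\<^sub>R w"
    using symmetric_eigenvector_in_invariant_subspace[OF sym subspace_hyperplane[of u]]
    by (metis (mono_tags, lifting) mem_Collect_eq)
  have "{#a, b#} \<subseteq># ?M"
  proof (cases "a = b")
    case True
    have "2 \<le> dim {u, w}"
    proof -
      have "independent {u, w}"
        using u w by (intro pairwise_orthogonal_independent)
          (auto simp: pairwise_def orthogonal_def inner_commute)
      moreover have "u \<noteq> w" using u w by auto
      ultimately show ?thesis by (simp add: dim_eq_card_independent)
    qed
    also have "\<dots> \<le> dim (eigenspace A a)"
      using u w True by (intro dim_subset) (auto simp: eigenspace_def)
    finally show ?thesis using True by (simp add: subseteq_mset_def count)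
  next
    case False
    then show ?thesis
      using dim1[OF u] dim1[OF w(2,3)] by (auto simp: subseteq_mset_def count Suc_le_eq)
  qed
  then have "size {#a, b#} \<le> size ?M" by (rule size_mset_mono)
  then have "2 \<le> length (sorted_list_of_multiset ?M)"
    by (metis mset_sorted_list_of_multiset size_mset size_add_mset size_empty One_nat_def Suc_1)
  then obtain c d xs where cd: "sorted_list_of_multiset ?M = c # d # xs"
    by (metis Suc_le_length_iff numeral_2_eq_2)
  then have M: "?M = {#c, d#} + mset xs"
    by (metis mset_sorted_list_of_multiset mset.simps(2) add_mset_add_single union_mset_add_mset_left add_0)
  have "0 < c + d"
  proof (cases "c = d")
    case True
    then have "2 \<le> dim (eigenspace A c)" unfolding count[symmetric] by (simp add: M)
    then obtain v v' where "v \<in> eigenspace A c" "v' \<in> eigenspace A c" "v \<noteq> 0" "v' \<noteq> 0" "v \<bullet> v' = 0"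
      using orthogonal_pair_if_dim_ge_2[OF subspace_eigenspace] by blast
    then show ?thesis using pos'[of v v' c c] True by (simp add: eigenspace_def)
  next
    case False
    have "0 < dim (eigenspace A c)" "0 < dim (eigenspace A d)"
      unfolding count[symmetric] by (simp_all add: M)
    then obtain v v' where "v \<in> eigenspace A c" "v' \<in> eigenspace A d" "v \<noteq> 0" "v' \<noteq> 0"
      by (metis dim_eq_0 less_numeral_extra(3) singleton_iff subsetI)
    then show ?thesis
      using pos'[of v v' c d] False symmetric_eigenvectors_orthogonal[OF sym, of v c v' d]
      by (simp add: eigenspace_def)
  qed
  then show ?thesis by (simp add: sum_two_lowest_eigenvalues_def cd)
qed

section \<open>Mean-convex barriers\<close>

text \<open>Where \<open>g\<close> is nonpositive, \<open>s\<close> is positive and by compactness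
  bounded away from 0, so a large multiple of it outweighs \<open>g\<close>.\<close>

lemma compact_penalty:
  fixes g s :: "'a::topological_space \<Rightarrow> real"
  assumes K: "compact K" and g: "continuous_on K g" and s: "continuous_on K s"
    and s0: "\<And>x. x \<in> K \<Longrightarrow> 0 \<le> s x" and pos: "\<And>x. x \<in> K \<Longrightarrow> s x = 0 \<Longrightarrow> 0 < g x"
  obtains k where "0 < k" "\<And>x. x \<in> K \<Longrightarrow> 0 < k * s x + g x"
proof -
  define N where "N = K \<inter> g -` {..0}"
  show thesis
  proof (cases "N = {}")
    case True
    then have "0 < 1 * s x + g x" if "x \<in> K" for x
      using s0[OF that] that by (force simp: N_def)
    then show thesis using that zero_less_one by blast
  next
    case False
    have "compact N"
      unfolding N_def
      by (rule closedin_compact[OF K continuous_closedin_preimage[OF g closed_atMost]])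
    moreover have cont: "continuous_on N g" "continuous_on N s"
      using g s by (auto simp: N_def intro: continuous_on_subset)
    ultimately obtain y z where y: "y \<in> N" "\<And>x. x \<in> N \<Longrightarrow> g y \<le> g x"
      and z: "z \<in> N" "\<And>x. x \<in> N \<Longrightarrow> s z \<le> s x"
      using continuous_attains_inf[OF \<open>compact N\<close> False] by metis
    have "0 < s z"
      using z(1) s0[of z] pos[of z] by (force simp: N_def)
    \<comment> \<open>On \<open>N\<close> this makes the sum at least 1; off \<open>N\<close>
      already \<open>g\<close> is positive.\<close>
    define k where "k = (1 - g y) / s z"
    have gy: "g y \<le> 0" using y by (simp add: N_def)
    have k: "0 < k" using \<open>0 < s z\<close> gy by (simp add: k_def)
    have "0 < k * s x + g x" if x: "x \<in> K" for x
    proof (cases "x \<in> N")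
      case True
      have "1 - g y = k * s z" using \<open>0 < s z\<close> by (simp add: k_def)
      also have "\<dots> \<le> k * s x" using z True k by simp
      finally show ?thesis using y(2)[OF True] by linarith
    next
      case False
      then show ?thesis using x k s0[OF x] by (simp add: N_def add_nonneg_pos)
    qed
    with k that show thesis by blast
  qed
qed

text \<open>The factor \<open>k\<close> penalises the planes that are not tangent to the level set of \<open>f\<close>, so
  positivity of the Hessian trace is needed on the tangent plane only.\<close>

lemma no_mean_convex_barrier:
  fixes f :: "real ^ 3 \<Rightarrow> real" and B :: "real ^ 3 \<Rightarrow> real ^ 3 \<Rightarrow> real ^ 3"
  assumes Z: "two_zero_set Z" and p: "local_max_on f Z p"
    and f: "\<And>x. (f has_derivative (\<lambda>h. g x \<bullet> h)) (at x)"
    and g: "\<And>x. (g has_derivative B x) (at x)"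
    and B: "\<And>h. continuous_on UNIV (\<lambda>x. B x h)"
    and sym: "\<And>u w. u \<bullet> B p w = B p u \<bullet> w"
    and pos: "\<And>u w. norm u = 1 \<Longrightarrow> norm w = 1 \<Longrightarrow> u \<bullet> w = 0 \<Longrightarrow> g p \<bullet> u = 0 \<Longrightarrow> g p \<bullet> w = 0
                \<Longrightarrow> 0 < u \<bullet> B p u + w \<bullet> B p w"
  shows False
proof -
  \<comment> \<open>These are the orthonormal pairs; the penalty vanishes exactly on those
    orthogonal to \<open>g p\<close>.\<close>
  define K :: "((real ^ 3) \<times> (real ^ 3)) set" where
    "K = (sphere 0 1 \<times> sphere 0 1) \<inter> {x. fst x \<bullet> snd x = 0}"
  have lin: "linear (B p)" using g has_derivative_linear by blast
  have "compact K"
    unfolding K_def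
    by (intro compact_Int_closed compact_Times compact_sphere closed_Collect_eq continuous_intros)
  moreover have "continuous_on K (\<lambda>x. fst x \<bullet> B p (fst x) + snd x \<bullet> B p (snd x))"
    by (intro continuous_intros linear_continuous_on_compose[OF _ lin])
  moreover have "continuous_on K (\<lambda>x. (g p \<bullet> fst x)\<^sup>2 + (g p \<bullet> snd x)\<^sup>2)"
    by (intro continuous_intros)
  ultimately obtain k where k: "0 < k" and kpos: "\<And>x. x \<in> K \<Longrightarrow>
      0 < k * ((g p \<bullet> fst x)\<^sup>2 + (g p \<bullet> snd x)\<^sup>2) + (fst x \<bullet> B p (fst x) + snd x \<bullet> B p (snd x))"
    by (rule compact_penalty) (auto simp: K_def intro!: pos)
  \<comment> \<open>An increasing function of \<open>f\<close> keeps the local maximum, and the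
    convexity of the exponential adds the rank-one penalty term to the Hessian.\<close>
  define F where "F x = exp (k * f x)" for x
  define D where "D x h = (k * F x) *\<^sub>R (k *\<^sub>R ((g x \<bullet> h) *\<^sub>R g x) + B x h)" for x h
  have F: "(F has_derivative (\<lambda>h. ((k * F x) *\<^sub>R g x) \<bullet> h)) (at x)" for x
    unfolding F_def by (auto intro!: derivative_eq_intros f simp: algebra_simps)
  have G: "((\<lambda>x. (k * F x) *\<^sub>R g x) has_derivative D x) (at x)" for x
    unfolding D_def by (auto intro!: derivative_eq_intros F g simp: algebra_simps)
  have cont: "continuous_on UNIV F" "continuous_on UNIV g"
    using F g by (auto intro!: continuous_at_imp_continuous_on has_derivative_continuous)
  have D: "continuous_on UNIV (\<lambda>x. D x h)" for h
    unfolding D_def by (intro continuous_intros cont B)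
  note C2 = C2_and_hessian[OF F G D]
  have "local_max_on F Z p"
    using p k by (simp add: local_max_on_def F_def)
  with Z C2(1) have le: "sum_two_lowest_eigenvalues (hessian F p) \<le> 0"
    by (simp add: two_zero_set_def)
  have quad: "x \<bullet> (hessian F p *v x) = (k * F p) * (k * (g p \<bullet> x)\<^sup>2 + x \<bullet> B p x)" for x
    by (simp add: C2(2) D_def inner_add_right inner_commute[of x "g p"] power2_eq_square)
  have "0 < sum_two_lowest_eigenvalues (hessian F p)"
  proof (rule sum_two_lowest_eigenvalues_pos)
    show "x \<bullet> (hessian F p *v y) = (hessian F p *v x) \<bullet> y" for x y
      by (simp add: C2(2) D_def inner_add_right inner_add_left sym inner_commute[of x "g p"] mult_ac)
    fix u w :: "real ^ 3" assume "norm u = 1" "norm w = 1" "u \<bullet> w = 0"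
    then have "0 < (k * F p) * (k * ((g p \<bullet> u)\<^sup>2 + (g p \<bullet> w)\<^sup>2) + (u \<bullet> B p u + w \<bullet> B p w))"
      using kpos[of "(u, w)"] k by (intro mult_pos_pos) (auto simp: K_def F_def)
    also have "\<dots> = u \<bullet> (hessian F p *v u) + w \<bullet> (hessian F p *v w)"
      unfolding quad by (simp add: algebra_simps)
    finally show "0 < u \<bullet> (hessian F p *v u) + w \<bullet> (hessian F p *v w)" .
  qed simp
  with le show False by simp
qed

text \<open>Parseval for the orthogonal basis \<open>u\<close>, \<open>w\<close>, \<open>v\<close>.
  It expresses a trace over the plane normal to \<open>v\<close> without reference to the chosen
  frame.\<close>

lemma Pythagoras_plane:
  fixes v a :: "real ^ 3"
  assumes "norm u = 1" "norm w = 1" "u \<bullet> w = 0" "v \<bullet> u = 0" "v \<bullet> w = 0" "v \<noteq> 0"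
  shows "(a \<bullet> u)\<^sup>2 + (a \<bullet> w)\<^sup>2 = a \<bullet> a - (a \<bullet> v)\<^sup>2 / (v \<bullet> v)"
proof -
  have 1: "u \<bullet> u = 1" "w \<bullet> w = 1" using assms by (simp_all add: dot_square_norm)
  have ne: "u \<noteq> w" "u \<noteq> v" "w \<noteq> v" using 1 assms by auto
  have "pairwise orthogonal {u, w, v}"
    using assms by (auto simp: pairwise_def orthogonal_def inner_commute)
  moreover have "0 \<notin> {u, w, v}" using assms by auto
  ultimately have "independent {u, w, v}" by (rule pairwise_orthogonal_independent)
  then have span: "span {u, w, v} = UNIV"
    using ne by (simp add: dim_eq_full[symmetric] dim_eq_card_independent)
  define r where "r = a - (a \<bullet> u) *\<^sub>R u - (a \<bullet> w) *\<^sub>R w - ((a \<bullet> v) / (v \<bullet> v)) *\<^sub>R v"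
  have "orthogonal r x" if "x \<in> {u, w, v}" for x
    using that assms 1 by (auto simp: r_def orthogonal_def inner_simps inner_commute)
  then have "orthogonal r r"
    using orthogonal_to_span[of r "{u, w, v}" r] span by auto
  then have "r = 0" by (simp add: orthogonal_self)
  then have "a = (a \<bullet> u) *\<^sub>R u + (a \<bullet> w) *\<^sub>R w + ((a \<bullet> v) / (v \<bullet> v)) *\<^sub>R v"
    by (simp add: r_def algebra_simps)
  then have "a \<bullet> a = a \<bullet> ((a \<bullet> u) *\<^sub>R u + (a \<bullet> w) *\<^sub>R w + ((a \<bullet> v) / (v \<bullet> v)) *\<^sub>R v)" by simp
  then show ?thesis by (simp add: inner_simps power2_eq_square)
qed

section \<open>The barrier\<close>

text \<open>As a function of \<open>t = r\<^sup>2\<close>, a radial function \<open>H(t)\<close> has planar Laplacian \<open>4 (t H'(t))'\<close>.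
  Here \<open>t H'(t) = t (t + 1) / (1 + t\<^sup>2)\<close> tends to 1 from above and strictly decreases for
  \<open>t \<ge> 3\<close>, so \<open>H\<close> is smooth, unbounded, and strictly superharmonic away from the axis. (An unbounded
  increasing \<open>H\<close> that is smooth on the axis cannot be superharmonic everywhere.)\<close>

definition profile :: "real \<Rightarrow> real" where
  "profile t = ln (1 + t\<^sup>2) / 2 + arctan t"

definition profile' :: "real \<Rightarrow> real" where
  "profile' t = (t + 1) / (1 + t\<^sup>2)"

definition profile'' :: "real \<Rightarrow> real" where
  "profile'' t = (1 - 2 * t - t\<^sup>2) / (1 + t\<^sup>2)\<^sup>2"

lemma one_plus_sq_pos: "0 < 1 + (t::real)\<^sup>2"
  by (simp add: add_pos_nonneg)

lemma has_real_derivative_profile: "(profile has_real_derivative profile' t) (at t)"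
proof -
  have "((\<lambda>t. ln (1 + t\<^sup>2)) has_real_derivative t / (1 + t\<^sup>2) * 2) (at t)"
    using one_plus_sq_pos[of t] by (auto intro!: derivative_eq_intros)
  from DERIV_add[OF DERIV_cdivide[OF this, of 2] DERIV_arctan]
  show ?thesis
    unfolding profile_def[abs_def] profile'_def add_divide_distrib inverse_eq_divide
      nonzero_mult_div_cancel_right[OF zero_neq_numeral[symmetric]] .
qed

lemma has_real_derivative_profile': "(profile' has_real_derivative profile'' t) (at t)"
proof -
  have "(profile' has_real_derivative (1 * (1 + t\<^sup>2) - (t + 1) * (2 * t)) / ((1 + t\<^sup>2) * (1 + t\<^sup>2))) (at t)"
    unfolding profile'_def[abs_def] using one_plus_sq_pos[of t]
    by (intro DERIV_divide) (auto intro!: derivative_eq_intros)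
  also have "(1 * (1 + t\<^sup>2) - (t + 1) * (2 * t)) / ((1 + t\<^sup>2) * (1 + t\<^sup>2)) = profile'' t"
    unfolding profile''_def by (simp add: power2_eq_square algebra_simps)
  finally show ?thesis .
qed

lemma continuous_on_profile'': "continuous_on S profile''"
  unfolding profile''_def by (intro continuous_intros) (use one_plus_sq_pos in \<open>auto simp: less_le\<close>)

lemma profile_0 [simp]: "profile 0 = 0"
  by (simp add: profile_def)

lemma profile_nonneg: "0 \<le> t \<Longrightarrow> 0 \<le> profile t"
  by (simp add: profile_def)

text \<open>The logarithmic term alone forces the growth. This quantitative unboundedness later
  confines the superlevel set of the comparison function.\<close>

lemma profile_le_imp:
  assumes "0 \<le> t" "profile t \<le> M"
  shows "t \<le> exp M"
proof -
  have "ln (1 + t\<^sup>2) \<le> 2 * M"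
    using assms(2) zero_le_arctan_iff[THEN iffD2, OF assms(1)] unfolding profile_def by linarith
  then have "1 + t\<^sup>2 \<le> exp (2 * M)"
    using one_plus_sq_pos[of t] by (metis exp_le_cancel_iff exp_ln)
  then have "t\<^sup>2 \<le> (exp M)\<^sup>2" by (simp add: exp_double)
  then show ?thesis by (rule power2_le_imp_le) simp
qed

text \<open>The left-hand side is, up to a positive factor, the mean curvature of the graph of
  \<open>e H(k r\<^sup>2)\<close>, with \<open>t = k r\<^sup>2\<close> and \<open>c = 4 e\<^sup>2 k\<close>.\<close>

lemma profile_supersolution:
  assumes "3 \<le> t" "0 \<le> c" "c \<le> 4 / 25"
  shows "profile' t * (2 + c * t * (profile' t)\<^sup>2) + 2 * t * profile'' t < 0"
proof -
  \<comment> \<open>The value 3 lies past the root 1 + sqrt 2 of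
    \<open>t\<^sup>2 - 2 * t - 1\<close>. At the extreme case \<open>c = 4 / 25\<close> the
    difference of the two sides has only positive coefficients in \<open>s\<close>.\<close>
  define s where "s = t - 3"
  have s: "0 \<le> s" "t = s + 3" using assms by (auto simp: s_def)
  let ?q = "1 + t\<^sup>2"
  have q: "0 < ?q" by (rule one_plus_sq_pos)
  have "c * (t * (t + 1) ^ 3) \<le> 4/25 * (t * (t + 1) ^ 3)"
    using assms by (intro mult_right_mono) auto
  also have "\<dots> < 2 * (t\<^sup>2 - 2 * t - 1) * ?q"
  proof -
    have "2 * (t\<^sup>2 - 2 * t - 1) * ?q - 4/25 * (t * (t + 1) ^ 3)
      = 232 / 25 + s * (46 * s ^ 3 + 440 * s\<^sup>2 + 1464 * s + 1768) / 25"
      unfolding s(2) by (simp add: algebra_simps power2_eq_square power3_eq_cube)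
    also have "\<dots> > 0" using s by (intro add_pos_nonneg) auto
    finally show ?thesis by simp
  qed
  finally have *: "c * (t * (t + 1) ^ 3) - 2 * (t\<^sup>2 - 2 * t - 1) * ?q < 0" by simp
  have "(t + 1) / Q * (2 + c * t * ((t + 1) / Q)\<^sup>2) + 2 * t * (R / Q\<^sup>2)
      = (2 * (t + 1) * Q\<^sup>2 + c * t * (t + 1) ^ 3 + 2 * t * R * Q) / Q ^ 3" if "0 < Q" for Q R
    using that by (simp add: divide_simps) (simp add: algebra_simps power2_eq_square power3_eq_cube)
  from this[OF q, of "1 - 2 * t - t\<^sup>2"]
  have "profile' t * (2 + c * t * (profile' t)\<^sup>2) + 2 * t * profile'' t
      = (2 * (t + 1) * ?q\<^sup>2 + c * t * (t + 1) ^ 3 + 2 * t * (1 - 2 * t - t\<^sup>2) * ?q) / ?q ^ 3"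
    unfolding profile'_def profile''_def .
  also have "\<dots> = (c * (t * (t + 1) ^ 3) - 2 * (t\<^sup>2 - 2 * t - 1) * ?q) / ?q ^ 3"
    by (rule arg_cong2[where f = "(/)"]) (simp_all add: algebra_simps power2_eq_square power3_eq_cube)
  also have "\<dots> < 0" using * q by (simp add: divide_neg_pos)
  finally show ?thesis .
qed


text \<open>Here \<open>rho\<close> is the squared distance to the line through \<open>q\<close>
  with direction \<open>n\<close>. Where \<open>k * rho x \<ge> 3\<close>, the Hessian trace over
  the tangent plane of the level set is a negative multiple of the expression in
  \<open>profile_supersolution\<close>, so no maximum can occur there.\<close>

lemma barrier_max_near_axis:
  fixes n q p :: "real ^ 3"
  defines "rho \<equiv> \<lambda>x. (x - q) \<bullet> (x - q) - (n \<bullet> (x - q))\<^sup>2"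
  assumes Z: "two_zero_set Z" and n: "norm n = 1" and e: "0 < e" and k: "0 < k" and ek: "e\<^sup>2 * k \<le> 1 / 25"
    and p: "local_max_on (\<lambda>x. n \<bullet> (x - q) - e * profile (k * rho x)) Z p"
  shows "k * rho p < 3"
proof (rule ccontr)
  assume "\<not> k * rho p < 3"
  then have t3: "3 \<le> k * rho p" by simp
  \<comment> \<open>The projection along \<open>n\<close> satisfies
    \<open>rho x = P (x - q) \<bullet> P (x - q)\<close>, so the gradient of \<open>rho\<close> is
    twice \<open>P (x - q)\<close>.\<close>
  define P where "P y = y - (n \<bullet> y) *\<^sub>R n" for y :: "real ^ 3"
  define g where "g x = n - (2 * e * k * profile' (k * rho x)) *\<^sub>R P (x - q)" for x
  define B where "B x h = - ((2 * e * k * profile' (k * rho x)) *\<^sub>R P h)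
      - (4 * e * k\<^sup>2 * profile'' (k * rho x) * (P (x - q) \<bullet> h)) *\<^sub>R P (x - q)" for x h
  have nn: "n \<bullet> n = 1" using n by (simp only: dot_square_norm power_one)
  have P: "n \<bullet> P y = 0" "P y \<bullet> n = 0" for y
    by (simp_all add: P_def inner_simps nn inner_commute)
  have Psym: "u \<bullet> P w = P u \<bullet> w" for u w
    by (simp add: P_def inner_simps inner_commute)
  have PP: "P (x - q) \<bullet> P (x - q) = rho x" for x
    unfolding P_def rho_def by (simp add: inner_diff nn inner_commute power2_eq_square algebra_simps)
  have rho: "(rho has_derivative (\<lambda>h. 2 * (P (x - q) \<bullet> h))) (at x)" for x
    unfolding rho_def P_def
    by (auto intro!: derivative_eq_intros simp: inner_diff algebra_simps inner_commute)
  have P': "((\<lambda>x. P (x - q)) has_derivative P) (at x)" for x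
    unfolding P_def by (auto intro!: derivative_eq_intros)
  have prof: "((\<lambda>x. profile (k * rho x)) has_derivative
      (\<lambda>h. k * (2 * (P (x - q) \<bullet> h)) * profile' (k * rho x))) (at x)" for x
    by (rule DERIV_compose_FDERIV[OF has_real_derivative_profile has_derivative_mult_right[OF rho]])
  have prof': "((\<lambda>x. profile' (k * rho x)) has_derivative
      (\<lambda>h. k * (2 * (P (x - q) \<bullet> h)) * profile'' (k * rho x))) (at x)" for x
    by (rule DERIV_compose_FDERIV[OF has_real_derivative_profile' has_derivative_mult_right[OF rho]])
  have f: "((\<lambda>x. n \<bullet> (x - q) - e * profile (k * rho x)) has_derivative (\<lambda>h. g x \<bullet> h)) (at x)" for x
    unfolding g_def by (auto intro!: derivative_eq_intros prof simp: inner_diff)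
  have g: "(g has_derivative B x) (at x)" for x
    unfolding g_def[abs_def] B_def[abs_def]
    by (auto intro!: derivative_eq_intros prof' P' simp: power2_eq_square algebra_simps)
  have contP: "continuous_on UNIV (\<lambda>x. P (x - q))"
    unfolding P_def by (intro continuous_intros)
  have contr: "continuous_on UNIV rho"
    unfolding rho_def by (intro continuous_intros)
  have B: "continuous_on UNIV (\<lambda>x. B x h)" for h
    unfolding B_def
    by (intro continuous_intros contP contr continuous_on_compose2[OF continuous_on_profile'', of UNIV]
        continuous_on_compose2[OF DERIV_continuous_on[OF has_real_derivative_profile'], of UNIV]) auto
  define t where "t = k * rho p"
  define Y where "Y = P (p - q)"
  define a where "a = 2 * e * k * profile' t"
  define b where "b = 4 * e * k\<^sup>2 * profile'' t"
  have Bp: "B p h = - (a *\<^sub>R P h) - (b * (Y \<bullet> h)) *\<^sub>R Y" for h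
    by (simp add: B_def a_def b_def Y_def t_def)
  show False
  proof (rule no_mean_convex_barrier[OF Z p f g B])
    show "u \<bullet> B p w = B p u \<bullet> w" for u w
      by (simp add: Bp inner_diff_left inner_diff_right inner_commute[of u Y] Psym)
  next
    fix u w :: "real ^ 3"
    assume uw: "norm u = 1" "norm w = 1" "u \<bullet> w = 0" "g p \<bullet> u = 0" "g p \<bullet> w = 0"
    \<comment> \<open>This is the squared length of the normal \<open>g p\<close>.\<close>
    define V where "V = 1 + a\<^sup>2 * rho p"
    have r: "0 < rho p"
      by (rule zero_less_mult_pos[OF _ k]) (use t3 in simp)
    then have V: "0 < V" by (simp add: V_def add_pos_nonneg)
    have gp: "g p = n - a *\<^sub>R Y" by (simp add: g_def a_def Y_def t_def)
    have YY: "Y \<bullet> Y = rho p" "n \<bullet> Y = 0" "Y \<bullet> n = 0" by (simp_all add: Y_def PP P)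
    have gg: "g p \<bullet> g p = V" "n \<bullet> g p = 1" "Y \<bullet> g p = - (a * rho p)"
      by (simp_all add: gp inner_diff nn YY V_def power2_eq_square)
    have "g p \<noteq> 0" using gg V by auto
    note pyth = Pythagoras_plane[OF uw this]
    have quad: "v \<bullet> B p v = - (a * (1 - (n \<bullet> v)\<^sup>2) + b * (Y \<bullet> v)\<^sup>2)" if "norm v = 1" for v
    proof -
      have "v \<bullet> v = 1" using that by (simp only: dot_square_norm power_one)
      then have "v \<bullet> P v = 1 - (n \<bullet> v)\<^sup>2"
        by (simp add: P_def inner_diff inner_commute power2_eq_square)
      then show ?thesis
        by (simp add: Bp inner_diff_right inner_commute[of v Y] power2_eq_square)
    qed
    have "u \<bullet> B p u + w \<bullet> B p w
        = - (a * (2 - ((n \<bullet> u)\<^sup>2 + (n \<bullet> w)\<^sup>2)) + b * ((Y \<bullet> u)\<^sup>2 + (Y \<bullet> w)\<^sup>2))"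
      by (simp add: quad uw algebra_simps)
    \<comment> \<open>\<open>Pythagoras_plane\<close> with normal \<open>g p\<close> is applied to
      \<open>n\<close> and to \<open>Y\<close>.\<close>
    also have "\<dots> = - (a * (1 + 1 / V) + b * (rho p - (a * rho p)\<^sup>2 / V))"
      by (simp add: pyth gg nn YY)
    also have "\<dots> = - ((a * (V + 1) + b * rho p * (V - a\<^sup>2 * rho p)) / V)"
      using V by (simp add: field_simps power2_eq_square)
    \<comment> \<open>This uses \<open>V - a\<^sup>2 * rho p = 1\<close> and the value
      \<open>4 * (e\<^sup>2 * k) * t * (profile' t)\<^sup>2\<close> of
      \<open>a\<^sup>2 * rho p\<close>.\<close>
    also have "\<dots> = - (2 * e * k * (profile' t * (2 + (4 * (e\<^sup>2 * k)) * t * (profile' t)\<^sup>2)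
        + 2 * t * profile'' t) / V)"
      by (simp add: V_def a_def b_def t_def power2_eq_square algebra_simps)
    also have "\<dots> > 0"
    proof -
      have "profile' t * (2 + (4 * (e\<^sup>2 * k)) * t * (profile' t)\<^sup>2) + 2 * t * profile'' t < 0"
      proof (rule profile_supersolution)
        show "4 * (e\<^sup>2 * k) \<le> 4 / 25" using ek by linarith
      qed (use t3 k in \<open>simp_all add: t_def\<close>)
      then show ?thesis
        using e k V unfolding neg_0_less_iff_less by (intro divide_neg_pos mult_pos_neg) auto
    qed
    finally show "0 < u \<bullet> B p u + w \<bullet> B p w" .
  qed
qed

section \<open>The halfspace theorem\<close>

text \<open>The contradiction is in the height of the maximum point: comparison with
  \<open>x0\<close> puts the value of \<open>f\<close> above \<open>- (d / 2)\<close>, but near the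
  axis the missing ball pushes \<open>Z\<close> below that height.\<close>

lemma two_zero_set_contains_touching_plane:
  fixes n q :: "real ^ 3"
  assumes Z: "two_zero_set Z" and n: "norm n = 1"
    and below: "\<And>x. x \<in> Z \<Longrightarrow> n \<bullet> (x - q) \<le> 0"
    and close: "\<And>d. 0 < d \<Longrightarrow> \<exists>x\<in>Z. - d < n \<bullet> (x - q)"
  shows "q \<in> Z"
proof (rule ccontr)
  assume "q \<notin> Z"
  have "closed Z" using Z by (simp add: two_zero_set_def)
  then obtain d where d: "0 < d" and dist: "\<And>x. x \<in> Z \<Longrightarrow> d \<le> dist q x"
    using \<open>q \<notin> Z\<close> separate_point_closed by metis
  define rho where "rho x = (x - q) \<bullet> (x - q) - (n \<bullet> (x - q))\<^sup>2" for x
  \<comment> \<open>Then \<open>k * rho p < 3\<close> means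
    \<open>rho p < 3 / 4 * d\<^sup>2\<close>, which leaves more than \<open>d\<^sup>2 / 4\<close>
    for the squared height at distance at least \<open>d\<close> from \<open>q\<close>.\<close>
  define k where "k = 4 / d\<^sup>2"
  have k: "0 < k" using d by (simp add: k_def)
  have rho0: "0 \<le> rho x" for x
    using Cauchy_Schwarz_ineq[of n "x - q"] n by (simp add: rho_def dot_square_norm[of n])
  have prof0: "0 \<le> profile (k * rho x)" for x
    using k rho0 by (simp add: profile_nonneg)
  obtain x0 where x0: "x0 \<in> Z" "- (d / 4) < n \<bullet> (x0 - q)"
    using close[of "d / 4"] d by auto
  define M where "M = profile (k * rho x0)"
  have M: "0 \<le> M" by (simp add: M_def prof0)
  \<comment> \<open>The first bound gives \<open>e\<^sup>2 * k \<le> 1 / 25\<close>, the second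
    keeps the penalty at \<open>x0\<close> below \<open>d / 4\<close>; \<open>M + 1\<close> avoids
    division by 0.\<close>
  define e where "e = min (d / 10) (d / (4 * (M + 1)))"
  have e: "0 < e" using d M by (simp add: e_def)
  have "e \<le> d / 10" unfolding e_def by (rule min.cobounded1)
  then have "e\<^sup>2 * k \<le> (d / 10)\<^sup>2 * k"
    using e k by (intro mult_right_mono power_mono) auto
  then have ek: "e\<^sup>2 * k \<le> 1 / 25"
    using d by (simp add: k_def power_divide)
  have "e * M \<le> e * (M + 1)" using e by simp
  also have "\<dots> \<le> d / (4 * (M + 1)) * (M + 1)"
    unfolding e_def using M by (intro mult_right_mono min.cobounded2) simp
  also have "\<dots> = d / 4" using M by (simp add: field_simps)
  finally have eM: "e * M \<le> d / 4" .
  define f where "f x = n \<bullet> (x - q) - e * profile (k * rho x)" for x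
  have f0: "- (d / 2) < f x0" using x0 eM by (simp add: f_def M_def)
  define K where "K = Z \<inter> {x. f x0 \<le> f x}"
  have contf: "continuous_on UNIV f"
    unfolding f_def rho_def
    by (intro continuous_intros continuous_on_compose2[OF DERIV_continuous_on[OF has_real_derivative_profile], of UNIV]) auto
  \<comment> \<open>On \<open>K\<close> the height lies between \<open>- (d / 2)\<close> and 0, so
    the penalty is at most \<open>d / 2\<close>, which bounds the distance to the axis.\<close>
  have "norm (x - q) \<le> sqrt (exp (d / (2 * e)) / k + (d / 2)\<^sup>2)" if x: "x \<in> K" for x
  proof -
    have fx: "- (d / 2) < f x" and z: "n \<bullet> (x - q) \<le> 0"
      using x f0 below by (auto simp: K_def)
    have "e * profile (k * rho x) \<le> d / 2" using fx z by (simp add: f_def)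
    then have "profile (k * rho x) \<le> d / (2 * e)" using e by (simp add: field_simps)
    then have "k * rho x \<le> exp (d / (2 * e))" using profile_le_imp k rho0 by simp
    then have "rho x \<le> exp (d / (2 * e)) / k" using k by (simp add: field_simps)
    moreover have "- (d / 2) \<le> n \<bullet> (x - q)"
      using fx mult_nonneg_nonneg[OF less_imp_le[OF e] prof0[of x]] by (simp add: f_def)
    then have "(n \<bullet> (x - q))\<^sup>2 \<le> (d / 2)\<^sup>2" using z by (intro abs_le_square_iff[THEN iffD1]) auto
    ultimately have "(norm (x - q))\<^sup>2 \<le> exp (d / (2 * e)) / k + (d / 2)\<^sup>2"
      unfolding rho_def dot_square_norm by linarith
    then show ?thesis by (rule real_le_rsqrt)
  qed
  then have "K \<subseteq> cball q (sqrt (exp (d / (2 * e)) / k + (d / 2)\<^sup>2))"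
    by (auto simp: dist_norm norm_minus_commute)
  then have "bounded K" using bounded_cball bounded_subset by blast
  moreover have "closed K"
    unfolding K_def using \<open>closed Z\<close> contf by (intro closed_Int closed_Collect_le) auto
  ultimately have "compact K" by (simp add: compact_eq_bounded_closed)
  moreover have "x0 \<in> K" using x0 by (simp add: K_def)
  ultimately obtain p where p: "p \<in> K" "\<And>x. x \<in> K \<Longrightarrow> f x \<le> f p"
    using continuous_attains_sup[of K f] contf continuous_on_subset by blast
  \<comment> \<open>Points of \<open>Z\<close> outside \<open>K\<close> lie below the level of
    \<open>x0\<close>, so the maximum over \<open>K\<close> is one over \<open>Z\<close>.\<close>
  have "f x \<le> f p" if "x \<in> Z" for x
  proof (cases "x \<in> K")
    case False
    then show ?thesis using that p(2)[OF \<open>x0 \<in> K\<close>] by (simp add: K_def)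
  qed (use p in simp)
  then have "local_max_on f Z p"
    using p by (auto simp: local_max_on_def K_def eventually_at_filter)
  then have "k * rho p < 3"
    unfolding f_def rho_def by (rule barrier_max_near_axis[OF Z n e k ek])
  then have rp: "rho p < 3 / 4 * d\<^sup>2" using d by (simp add: k_def field_simps)
  have "p \<in> Z" "f x0 \<le> f p" using p by (auto simp: K_def)
  have "d \<le> norm (p - q)" using dist[OF \<open>p \<in> Z\<close>] by (simp add: dist_norm norm_minus_commute)
  then have "d\<^sup>2 \<le> (norm (p - q))\<^sup>2" using d by (intro power_mono) auto
  then have "(d / 2)\<^sup>2 < \<bar>n \<bullet> (p - q)\<bar>\<^sup>2"
    using rp unfolding rho_def dot_square_norm by (simp add: power_divide)
  then have "d / 2 < \<bar>n \<bullet> (p - q)\<bar>" by (rule power2_less_imp_less) simp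
  then have "n \<bullet> (p - q) < - (d / 2)" using below[OF \<open>p \<in> Z\<close>] by simp
  moreover have "f p \<le> n \<bullet> (p - q)"
    using mult_nonneg_nonneg[OF less_imp_le[OF e] prof0[of p]] by (simp add: f_def)
  ultimately show False using f0 \<open>f x0 \<le> f p\<close> by linarith
qed

lemma two_zero_set_contains_sup_plane:
  fixes a :: "real ^ 3"
  assumes Z: "two_zero_set Z" "Z \<noteq> {}" and a: "a \<noteq> 0" and bdd: "bdd_above ((\<lambda>x. a \<bullet> x) ` Z)"
  shows "{x. a \<bullet> x = (SUP z\<in>Z. a \<bullet> z)} \<subseteq> Z"
proof safe
  fix q assume q: "a \<bullet> q = (SUP z\<in>Z. a \<bullet> z)"
  have sgn: "sgn a \<bullet> (x - q) = (a \<bullet> x - a \<bullet> q) / norm a" for x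
    by (simp add: sgn_div_norm inner_diff_right divide_inverse algebra_simps)
  show "q \<in> Z"
  proof (rule two_zero_set_contains_touching_plane[OF Z(1)])
    show "norm (sgn a) = 1" using a by (simp add: norm_sgn)
  next
    fix x assume "x \<in> Z"
    then have "a \<bullet> x \<le> a \<bullet> q" unfolding q using bdd by (rule cSUP_upper)
    then show "sgn a \<bullet> (x - q) \<le> 0" by (simp add: sgn divide_nonpos_nonneg)
  next
    fix d :: real assume "0 < d"
    then have "a \<bullet> q - d * norm a < (SUP z\<in>Z. a \<bullet> z)" using a q by simp
    then obtain x where "x \<in> Z" "a \<bullet> q - d * norm a < a \<bullet> x"
      using less_cSUP_iff[OF Z(2) bdd] by blast
    then show "\<exists>x\<in>Z. - d < sgn a \<bullet> (x - q)"
      using a by (intro bexI[of _ x]) (simp_all add: sgn field_simps)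
  qed
qed

theorem corollary7p4:
  fixes Z :: "(real ^ 3) set"
  assumes "two_zero_set Z"
    and "Z \<noteq> {}"
    and "\<exists>H. halfspace H \<and> Z \<subseteq> H"
  shows "(\<exists>P. plane P \<and> P \<subseteq> Z) \<and>
    (\<forall>L :: real ^ 3 \<Rightarrow> real.
      linear L \<and> \<not> L constant_on UNIV \<and> bdd_above (L ` Z)
        \<longrightarrow> {x. L x = (SUP z\<in>Z. L z)} \<subseteq> Z)"
proof (intro conjI allI impI)
  \<comment> \<open>The bounding plane at level \<open>b\<close> need not touch \<open>Z\<close>;
    the plane obtained is the one at the supremum.\<close>
  obtain a b where "a \<noteq> 0" and ab: "Z \<subseteq> {x. a \<bullet> x \<le> b}"
    using assms(3) by (auto simp: halfspace_def)
  have "bdd_above ((\<lambda>x. a \<bullet> x) ` Z)"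
    using ab by (intro bdd_aboveI2[of _ _ b]) auto
  with \<open>a \<noteq> 0\<close> show "\<exists>P. plane P \<and> P \<subseteq> Z"
    using two_zero_set_contains_sup_plane[OF assms(1,2)] unfolding plane_def by blast
next
  fix L :: "real ^ 3 \<Rightarrow> real"
  assume L: "linear L \<and> \<not> L constant_on UNIV \<and> bdd_above (L ` Z)"
  \<comment> \<open>This is the vector representing \<open>L\<close>; it is nonzero because
    \<open>L\<close> is not constant.\<close>
  define a where "a = adjoint L 1"
  have La: "L = (\<lambda>x. a \<bullet> x)"
    using adjoint_works[of L _ 1] L by (auto simp: a_def inner_commute)
  moreover have "a \<noteq> 0"
    using L La by (auto simp: constant_on_def)
  ultimately show "{x. L x = (SUP z\<in>Z. L z)} \<subseteq> Z"
    using two_zero_set_contains_sup_plane[OF assms(1,2)] L by simp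
qed

end
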